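(* Let $\mathfrak{g}=(\mathfrak{g},[~,~]_1,[~,~]_2,\alpha)$ be a compatible Hom-Lie algebra and $V=(V,\bullet_1,\bullet_2,\beta)$ a representation of it. Let $\mathfrak{g}_+=(\mathfrak{g},[~,~]_1+[~,~]_2,\alpha)$, a Hom-Lie algebra, and $V_+=(V,\bullet_1+\bullet_2,\beta)$, a representation of $\mathfrak{g}_+$. For $n\ge0$ define $\triangle_n:C^n_{\mathrm{cHom}}(\mathfrak{g},V)\to C^n_{\mathrm{Hom}}(\mathfrak{g}_+,V_+)$ by $\triangle_0(v)=\tfrac12v$ and $\triangle_n((f_1,\ldots,f_n))=f_1+\cdots+f_n$ for $n\ge1$. Then the collection $\{\triangle_n\}_{n\ge0}$ defines a morphism of cochain complexes from $\{C^\ast_{\mathrm{cHom}}(\mathfrak{g},V),\delta_{\mathrm{cHom}}\}$ to $\{C^\ast_{\mathrm{Hom}}(\mathfrak{g}_+,V_+),\delta_{\mathrm{Hom}}\}$. Hence it induces a morphism $H^\ast_{\mathrm{cHom}}(\mathfrak{g},V)\to H^\ast_{\mathrm{Hom}}(\mathfrak{g}_+,V_+)$ between the corresponding cohomologies.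
   Context: All vector spaces are over a field $\mathbb{K}$ of characteristic zero. A Hom-Lie algebra $(\mathfrak{g},[~,~],\alpha)$ is a vector space $\mathfrak{g}$ with a bilinear skew-symmetric bracket and a linear map $\alpha:\mathfrak{g}\to\mathfrak{g}$ such that $\alpha[x,y]=[\alpha(x),\alpha(y)]$ and $[[x,y],\alpha(z)]+[[y,z],\alpha(x)]+[[z,x],\alpha(y)]=0$ for all $x,y,z\in\mathfrak{g}$. A compatible Hom-Lie algebra $(\mathfrak{g},[~,~]_1,[~,~]_2,\alpha)$ consists of two Hom-Lie algebras $(\mathfrak{g},[~,~]_1,\alpha)$, $(\mathfrak{g},[~,~]_2,\alpha)$ such that $(\mathfrak{g},\lambda[~,~]_1+\eta[~,~]_2,\alpha)$ is a Hom-Lie algebra for all $\lambda,\eta\in\mathbb{K}$. A representation $(V,\bullet,\beta)$ of a Hom-Lie algebra $(\mathfrak{g},[~,~],\alpha)$ is a vector space $V$ with a bilinear map $\bullet:\mathfrak{g}\otimes V\to V$ and a linear map $\beta:V\to V$ such that $\beta(x\bullet v)=\alpha(x)\bullet\beta(v)$ and $[x,y]\bullet\beta(v)=\alpha(x)\bullet(y\bullet v)-\alpha(y)\bullet(x\bullet v)$. A representation of a compatible Hom-Lie algebra is a quadruple $(V,\bullet_1,\bullet_2,\beta)$ such that $(V,\bullet_i,\beta)$ is a representation of $(\mathfrak{g},[~,~]_i,\alpha)$ for $i=1,2$, and for all $x,y\in\mathfrak{g}$, $v\in V$, $$[x,y]_1\bullet_2\beta(v)+[x,y]_2\bullet_1\beta(v)=\alpha(x)\bullet_1(y\bullet_2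 v)-\alpha(y)\bullet_2(x\bullet_1 v)+\alpha(x)\bullet_2(y\bullet_1 v)-\alpha(y)\bullet_1(x\bullet_2 v).$$ Hom-Lie cochain complex: $C^0_{\mathrm{Hom}}(\mathfrak{g},V)=\{v\in V\mid\beta(v)=v\}$ and $C^n_{\mathrm{Hom}}(\mathfrak{g},V)=\{f:\wedge^n\mathfrak{g}\to V\text{ linear}\mid\beta\circ f=f\circ\alpha^{\wedge n}\}$ for $n\ge1$. The coboundary of $(\mathfrak{g},[~,~],\alpha)$ with coefficients in $(V,\bullet,\beta)$ is $(\delta_{\mathrm{Hom}}v)(x)=x\bullet v$ for $v\in C^0_{\mathrm{Hom}}(\mathfrak{g},V)$, and for $f\in C^n_{\mathrm{Hom}}(\mathfrak{g},V)$, $n\ge1$, $$(\delta_{\mathrm{Hom}}f)(x_1,\ldots,x_{n+1})=\sum_{i=1}^{n+1}(-1)^{i+1}\alpha^{n-1}(x_i)\bullet f(x_1,\ldots,\widehat{x_i},\ldots,x_{n+1})+\sum_{1\le i<j\le n+1}(-1)^{i+j}f([x_i,x_j],\alpha(x_1),\ldots,\widehat{\alpha(x_i)},\ldots,\widehat{\alpha(x_j)},\ldots,\alpha(x_{n+1})).$$ Its cohomology is $H^\ast_{\mathrm{Hom}}(\mathfrak{g},V)$. For a compatible Hom-Lie algebra $(\mathfrak{g},[~,~]_1,[~,~]_2,\alpha)$ with a representation $(V,\bullet_1,\bullet_2,\beta)$, ${}^i\delta_{\mathrm{Hom}}:C^n_{\mathrm{Hom}}(\mathfrak{g},V)\to C^{n+1}_{\mathrm{Hom}}(\mathfrak{g},V)$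 ($i=1,2$) denotes the coboundary operator $\delta_{\mathrm{Hom}}$ of the Hom-Lie algebra $(\mathfrak{g},[~,~]_i,\alpha)$ with coefficients in $(V,\bullet_i,\beta)$. Compatible cochain complex: $C^0_{\mathrm{cHom}}(\mathfrak{g},V)=\{v\in V\mid\beta(v)=v\text{ and }x\bullet_1v=x\bullet_2v\ \forall x\in\mathfrak{g}\}$ and $C^n_{\mathrm{cHom}}(\mathfrak{g},V)=C^n_{\mathrm{Hom}}(\mathfrak{g},V)^{\oplus n}$ ($n$ copies) for $n\ge1$. The coboundary is $\delta_{\mathrm{cHom}}(v)(x)=x\bullet_1v=x\bullet_2v$ for $v\in C^0_{\mathrm{cHom}}(\mathfrak{g},V)$, and for $n\ge1$ $$\delta_{\mathrm{cHom}}(f_1,\ldots,f_n)=\big({}^1\delta_{\mathrm{Hom}}f_1,\ldots,\underbrace{{}^1\delta_{\mathrm{Hom}}f_i+{}^2\delta_{\mathrm{Hom}}f_{i-1}}_{i\text{-th position},\ 2\le i\le n},\ldots,{}^2\delta_{\mathrm{Hom}}f_n\big).$$ Its cohomology is $H^n_{\mathrm{cHom}}(\mathfrak{g},V)=\ker(\delta_{\mathrm{cHom}}:C^n_{\mathrm{cHom}}\to C^{n+1}_{\mathrm{cHom}})/\mathrm{Im}(\delta_{\mathrm{cHom}}:C^{n-1}_{\mathrm{cHom}}\to C^n_{\mathrm{cHom}})$.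
   Formalization: With the printed formulas the composite of the coboundaries from degree 0 to degree 2 need not vanish, so that equation is not required of a cochain complex here, and degree-1 cohomology is taken as the image of the 1-cocycles in the 1-cochains modulo the 1-coboundaries. *)

theory Defs
  imports Complex_Main "HOL-Library.Function_Algebras" "HOL-Library.Set_Algebras"
begin

section \<open>Compatible Hom-Lie algebras and their representations\<close>

locale hom_lie_algebra = vector_space s
  for s :: "'k::field_char_0 \<Rightarrow> 'g::ab_group_add \<Rightarrow> 'g" +
  fixes br :: "'g \<Rightarrow> 'g \<Rightarrow> 'g" and al :: "'g \<Rightarrow> 'g"
  assumes linear_twist: "Vector_Spaces.linear s s al"
    and bracket_linear_left: "Vector_Spaces.linear s s (\<lambda>x. br x y)"
    and bracket_linear_right: "Vector_Spaces.linear s s (\<lambda>y. br x y)"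
    and bracket_skew: "br x y = - br y x"
    and bracket_twist: "al (br x y) = br (al x) (al y)"
    and hom_jacobi: "br (br x y) (al z) + br (br y z) (al x) + br (br z x) (al y) = 0"

locale compatible_hom_lie_algebra =
  fixes s :: "'k::field_char_0 \<Rightarrow> 'g::ab_group_add \<Rightarrow> 'g"
    and br1 br2 :: "'g \<Rightarrow> 'g \<Rightarrow> 'g" and al :: "'g \<Rightarrow> 'g"
  assumes hom_lie_1: "hom_lie_algebra s br1 al"
    and hom_lie_2: "hom_lie_algebra s br2 al"
    and hom_lie_combination:
      "hom_lie_algebra s (\<lambda>x y. s l (br1 x y) + s e (br2 x y)) al"

locale hom_lie_representation = alg: hom_lie_algebra s br al + rep: vector_space sv
  for s :: "'k::field_char_0 \<Rightarrow> 'g::ab_group_add \<Rightarrow> 'g"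
    and br :: "'g \<Rightarrow> 'g \<Rightarrow> 'g" and al :: "'g \<Rightarrow> 'g"
    and sv :: "'k \<Rightarrow> 'v::ab_group_add \<Rightarrow> 'v" +
  fixes act :: "'g \<Rightarrow> 'v \<Rightarrow> 'v" and be :: "'v \<Rightarrow> 'v"
  assumes linear_rep_twist: "Vector_Spaces.linear sv sv be"
    and act_linear_left: "Vector_Spaces.linear s sv (\<lambda>x. act x v)"
    and act_linear_right: "Vector_Spaces.linear sv sv (\<lambda>v. act x v)"
    and act_twist: "be (act x v) = act (al x) (be v)"
    and act_bracket: "act (br x y) (be v) = act (al x) (act y v) - act (al y) (act x v)"

locale compatible_hom_lie_representation =
  fixes s :: "'k::field_char_0 \<Rightarrow> 'g::ab_group_add \<Rightarrow> 'g"
    and br1 br2 :: "'g \<Rightarrow> 'g \<Rightarrow> 'g" and al :: "'g \<Rightarrow> 'g"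
    and sv :: "'k \<Rightarrow> 'v::ab_group_add \<Rightarrow> 'v"
    and act1 act2 :: "'g \<Rightarrow> 'v \<Rightarrow> 'v" and be :: "'v \<Rightarrow> 'v"
  assumes rep_1: "hom_lie_representation s br1 al sv act1 be"
    and rep_2: "hom_lie_representation s br2 al sv act2 be"
    and rep_compatible:
      "act2 (br1 x y) (be v) + act1 (br2 x y) (be v) =
         act1 (al x) (act2 y v) - act2 (al y) (act1 x v)
         + act2 (al x) (act1 y v) - act1 (al y) (act2 x v)"


section \<open>Cochain complexes and their morphisms\<close>

definition linear_between ::
  "('k \<Rightarrow> 'a::plus \<Rightarrow> 'a) \<Rightarrow> ('k \<Rightarrow> 'b::plus \<Rightarrow> 'b) \<Rightarrow> 'a set \<Rightarrow> 'b set \<Rightarrow> ('a \<Rightarrow> 'b) \<Rightarrow> bool"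
  where "linear_between s s' A B f \<longleftrightarrow>
    (\<forall>x\<in>A. f x \<in> B) \<and>
    (\<forall>x\<in>A. \<forall>y\<in>A. f (x + y) = f x + f y) \<and>
    (\<forall>c. \<forall>x\<in>A. f (s c x) = s' c (f x))"

text \<open>
  A cochain complex, except that \<open>d 1 \<circ> d 0 = 0\<close> is not required, as the formulas below violate it
  in general: for an invariant vector \<open>v\<close>, that is \<open>\<beta> v = v\<close>, they give
  \<open>(\<delta> (\<delta> v)) (x, y) = x \<bullet> (y \<bullet> v) - y \<bullet> (x \<bullet> v) - [x, y] \<bullet> v\<close>, whereas the axioms of a
  representation only give \<open>[x, y] \<bullet> v = \<alpha> x \<bullet> (y \<bullet> v) - \<alpha> y \<bullet> (x \<bullet> v)\<close>.
\<close>

locale cochain_complex = vector_space s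
  for s :: "'k::field_char_0 \<Rightarrow> 'a::ab_group_add \<Rightarrow> 'a" +
  fixes C :: "nat \<Rightarrow> 'a set" and d :: "nat \<Rightarrow> 'a \<Rightarrow> 'a"
  assumes subspace_cochains: "subspace (C n)"
    and differential: "linear_between s s (C n) (C (Suc n)) (d n)"
    and differential_squared: "0 < n \<Longrightarrow> c \<in> C n \<Longrightarrow> d (Suc n) (d n c) = 0"

locale cochain_morphism = src: cochain_complex s C d + tgt: cochain_complex s' C' d'
  for s :: "'k::field_char_0 \<Rightarrow> 'a::ab_group_add \<Rightarrow> 'a"
    and C :: "nat \<Rightarrow> 'a set" and d :: "nat \<Rightarrow> 'a \<Rightarrow> 'a"
    and s' :: "'k \<Rightarrow> 'b::ab_group_add \<Rightarrow> 'b"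
    and C' :: "nat \<Rightarrow> 'b set" and d' :: "nat \<Rightarrow> 'b \<Rightarrow> 'b" +
  fixes \<phi> :: "nat \<Rightarrow> 'a \<Rightarrow> 'b"
  assumes component: "linear_between s s' (C n) (C' n) (\<phi> n)"
    and commutes: "c \<in> C n \<Longrightarrow> \<phi> (Suc n) (d n c) = d' n (\<phi> n c)"

definition cocycles :: "(nat \<Rightarrow> 'a::ab_group_add set) \<Rightarrow> (nat \<Rightarrow> 'a \<Rightarrow> 'a) \<Rightarrow> nat \<Rightarrow> 'a set"
  where "cocycles C d n = {c \<in> C n. d n c = 0}"

definition coboundaries :: "(nat \<Rightarrow> 'a::ab_group_add set) \<Rightarrow> (nat \<Rightarrow> 'a \<Rightarrow> 'a) \<Rightarrow> nat \<Rightarrow> 'a set"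
  where "coboundaries C d n = (if n = 0 then {0} else d (n - 1) ` C (n - 1))"

text \<open>
  Cohomology is the set of cosets of the coboundaries with a cocycle as representative, also in
  degree one, where the coboundaries need not be cocycles. The sum of two cosets is their sum as sets; scalar multiplication needs the extra summand \<open>B\<close> because
  scaling a coset elementwise by zero would collapse it to \<open>{0}\<close>.
\<close>

definition cohomology_class ::
  "(nat \<Rightarrow> 'a::ab_group_add set) \<Rightarrow> (nat \<Rightarrow> 'a \<Rightarrow> 'a) \<Rightarrow> nat \<Rightarrow> 'a \<Rightarrow> 'a set"
  where "cohomology_class C d n z = z +o coboundaries C d n"

definition cohomology ::
  "(nat \<Rightarrow> 'a::ab_group_add set) \<Rightarrow> (nat \<Rightarrow> 'a \<Rightarrow> 'a) \<Rightarrow> nat \<Rightarrow> 'a set set"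
  where "cohomology C d n = cohomology_class C d n ` cocycles C d n"

definition coset_scale :: "('k \<Rightarrow> 'a::ab_group_add \<Rightarrow> 'a) \<Rightarrow> 'a set \<Rightarrow> 'k \<Rightarrow> 'a set \<Rightarrow> 'a set"
  where "coset_scale s B c A = s c ` A + B"


section \<open>The cochain spaces and coboundary operators\<close>

definition fun_scale :: "('k \<Rightarrow> 'v \<Rightarrow> 'v) \<Rightarrow> 'k \<Rightarrow> ('i \<Rightarrow> 'v) \<Rightarrow> 'i \<Rightarrow> 'v"
  where "fun_scale s c f = (\<lambda>x. s c (f x))"

text \<open>
  A linear map on the \<open>n\<close>-th exterior power is encoded as an alternating multilinear map on lists of
  length \<open>n\<close>, extended by zero to lists of other lengths so that equality of cochains is
  equality of functions.
\<close>

definition alternating_map ::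
  "('k::field_char_0 \<Rightarrow> 'g::ab_group_add \<Rightarrow> 'g) \<Rightarrow> ('k \<Rightarrow> 'v::ab_group_add \<Rightarrow> 'v) \<Rightarrow>
   nat \<Rightarrow> ('g list \<Rightarrow> 'v) \<Rightarrow> bool"
  where "alternating_map s sv n f \<longleftrightarrow>
    (\<forall>xs i. length xs = n \<longrightarrow> i < n \<longrightarrow> Vector_Spaces.linear s sv (\<lambda>x. f (xs[i := x]))) \<and>
    (\<forall>xs i j. length xs = n \<longrightarrow> i < j \<longrightarrow> j < n \<longrightarrow> xs ! i = xs ! j \<longrightarrow> f xs = 0) \<and>
    (\<forall>xs. length xs \<noteq> n \<longrightarrow> f xs = 0)"

text \<open>A vector is identified with the function of no arguments having it as value.\<close>

definition const_cochain :: "'v::zero \<Rightarrow> 'g list \<Rightarrow> 'v"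
  where "const_cochain v = (\<lambda>xs. if xs = [] then v else 0)"

definition hom_cochains ::
  "('k::field_char_0 \<Rightarrow> 'g::ab_group_add \<Rightarrow> 'g) \<Rightarrow> ('g \<Rightarrow> 'g) \<Rightarrow>
   ('k \<Rightarrow> 'v::ab_group_add \<Rightarrow> 'v) \<Rightarrow> ('v \<Rightarrow> 'v) \<Rightarrow> nat \<Rightarrow> ('g list \<Rightarrow> 'v) set"
  where "hom_cochains s al sv be n =
    (if n = 0 then const_cochain ` {v. be v = v}
     else {f. alternating_map s sv n f \<and> (\<forall>xs. length xs = n \<longrightarrow> be (f xs) = f (map al xs))})"

text \<open>
  Arguments are numbered from zero. This preserves the parity of \<open>i + j\<close> and turns the sign
  \<open>(-1)\<^sup>i\<^sup>+\<^sup>1\<close> into \<open>(-1)\<^sup>i\<close>. The list \<open>nths xs (- {i, j})\<close> omits the entries at \<open>i\<close> and \<open>j\<close>.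
\<close>

definition hom_coboundary ::
  "('g \<Rightarrow> 'g \<Rightarrow> 'g) \<Rightarrow> ('g \<Rightarrow> 'g) \<Rightarrow>
   ('k::field_char_0 \<Rightarrow> 'v::ab_group_add \<Rightarrow> 'v) \<Rightarrow> ('g \<Rightarrow> 'v \<Rightarrow> 'v) \<Rightarrow>
   nat \<Rightarrow> ('g list \<Rightarrow> 'v) \<Rightarrow> 'g list \<Rightarrow> 'v"
  where "hom_coboundary br al sv act n f = (\<lambda>xs.
    if length xs \<noteq> Suc n then 0
    else if n = 0 then act (xs ! 0) (f [])
    else
      (\<Sum>i<Suc n. sv ((-1) ^ i) (act ((al ^^ (n - 1)) (xs ! i)) (f (nths xs (- {i})))))
      + (\<Sum>j<Suc n. \<Sum>i<j. sv ((-1) ^ (i + j))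
           (f (br (xs ! i) (xs ! j) # map al (nths xs (- {i, j}))))))"

text \<open>
  A tuple \<open>(f\<^sub>1, \<dots>, f\<^sub>n)\<close> of cochains, \<open>n \<ge> 1\<close>, is a function on the naturals vanishing outside
  \<open>{1..n}\<close>. The otherwise unused slot zero holds the cochains of degree zero.
\<close>

definition chom_cochains ::
  "('k::field_char_0 \<Rightarrow> 'g::ab_group_add \<Rightarrow> 'g) \<Rightarrow> ('g \<Rightarrow> 'g) \<Rightarrow>
   ('k \<Rightarrow> 'v::ab_group_add \<Rightarrow> 'v) \<Rightarrow> ('g \<Rightarrow> 'v \<Rightarrow> 'v) \<Rightarrow> ('g \<Rightarrow> 'v \<Rightarrow> 'v) \<Rightarrow> ('v \<Rightarrow> 'v) \<Rightarrow>
   nat \<Rightarrow> (nat \<Rightarrow> 'g list \<Rightarrow> 'v) set"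
  where "chom_cochains s al sv act1 act2 be n =
    (if n = 0 then
       (\<lambda>v i. if i = 0 then const_cochain v else 0) ` {v. be v = v \<and> (\<forall>x. act1 x v = act2 x v)}
     else
       {F. (\<forall>i\<in>{1..n}. F i \<in> hom_cochains s al sv be n) \<and> (\<forall>i. i \<notin> {1..n} \<longrightarrow> F i = 0)})"

text \<open>In degree zero both actions give the same result on \<open>chom_cochains\<close>; the first is used.\<close>

definition chom_coboundary ::
  "('g \<Rightarrow> 'g \<Rightarrow> 'g) \<Rightarrow> ('g \<Rightarrow> 'g \<Rightarrow> 'g) \<Rightarrow> ('g \<Rightarrow> 'g) \<Rightarrow>
   ('k::field_char_0 \<Rightarrow> 'v::ab_group_add \<Rightarrow> 'v) \<Rightarrow> ('g \<Rightarrow> 'v \<Rightarrow> 'v) \<Rightarrow> ('g \<Rightarrow> 'v \<Rightarrow> 'v) \<Rightarrow>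
   nat \<Rightarrow> (nat \<Rightarrow> 'g list \<Rightarrow> 'v) \<Rightarrow> nat \<Rightarrow> 'g list \<Rightarrow> 'v"
  where "chom_coboundary br1 br2 al sv act1 act2 n F = (\<lambda>i.
    if n = 0 then (if i = 1 then hom_coboundary br1 al sv act1 0 (F 0) else 0)
    else if i = 1 then hom_coboundary br1 al sv act1 n (F 1)
    else if 2 \<le> i \<and> i \<le> n then
      hom_coboundary br1 al sv act1 n (F i) + hom_coboundary br2 al sv act2 n (F (i - 1))
    else if i = n + 1 then hom_coboundary br2 al sv act2 n (F n)
    else 0)"

definition triangle ::
  "('k::field_char_0 \<Rightarrow> 'v::ab_group_add \<Rightarrow> 'v) \<Rightarrow> nat \<Rightarrow> (nat \<Rightarrow> 'g list \<Rightarrow> 'v) \<Rightarrow> 'g list \<Rightarrow> 'v"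
  where "triangle sv n F = (if n = 0 then fun_scale sv (1/2) (F 0) else (\<Sum>i=1..n. F i))"

end

theory Submission
  imports Defs
begin

text \<open>
  Everything rests on three facts about the Hom-Lie coboundary \<open>\<delta>\<close>: it maps cochains to cochains, it
  squares to zero in positive degrees, and it is additive in the pair (bracket, action).

  By additivity, the coboundary of \<open>(\<gg>\<^sub>+, V\<^sub>+)\<close> is \<open>\<delta>\<^sub>1 + \<delta>\<^sub>2\<close>. The compatibility conditions make
  \<open>\<gg>\<^sub>+\<close> a Hom-Lie algebra and \<open>V\<^sub>+\<close> a representation of it,
  hence \<open>(\<delta>\<^sub>1 + \<delta>\<^sub>2)\<^sup>2 = 0\<close>. Subtracting \<open>\<delta>\<^sub>1\<^sup>2 = \<delta>\<^sub>2\<^sup>2 = 0\<close> leaves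
  \<open>\<delta>\<^sub>1 \<delta>\<^sub>2 + \<delta>\<^sub>2 \<delta>\<^sub>1 = 0\<close> (\<open>coboundaries_anticommute\<close>), which makes the compatible coboundary square to
  zero as well. The map \<open>\<triangle>\<close> commutes with the coboundaries since every \<open>f\<^sub>i\<close> enters the tuple
  \<open>\<delta>(f\<^sub>1, \<dots>, f\<^sub>n)\<close> once through \<open>\<delta>\<^sub>1\<close> and once through \<open>\<delta>\<^sub>2\<close>, so that the entries of this tuple add up to
  \<open>(\<delta>\<^sub>1 + \<delta>\<^sub>2)(f\<^sub>1 + \<dots> + f\<^sub>n)\<close>. In degree zero both actions agree on \<open>v\<close>, so
  \<open>(\<bullet>\<^sub>1 + \<bullet>\<^sub>2)\<close> applied to \<open>v / 2\<close> gives back \<open>x \<bullet>\<^sub>1 v\<close>; this is why \<open>\<triangle>\<^sub>0\<close> halves.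

  The main work is \<open>\<delta>\<^sup>2 = 0\<close> (\<open>coboundary_squared\<close>). It is organised around two signed sums over a list:
  \<open>pick\<close> takes out one entry, \<open>pick_pair\<close> takes out two. The coboundary is one \<open>pick\<close> plus one
  \<open>pick_pair\<close>, so \<open>\<delta>\<^sup>2\<close> is a combination of nested sums, and these obey formal rules, valid in any
  abelian group: picking two entries one after the other antisymmetrises (\<open>pick_pick\<close>), a pick
  commutes with a pair (\<open>pick_pick_pair\<close>), and a nested sum vanishes if its summand is skew with
  vanishing cyclic sums (\<open>pick_pair_cyclic\<close>) or changes sign when two pairs trade places (\<open>pick_pair_skew\<close>). These
  rules cancel, in this order, the terms of \<open>\<delta>\<^sup>2\<close> with two actions, by the representation axiom; with an
  action and a bracket; with nested brackets, by the Hom-Jacobi identity; and with two disjoint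
  brackets, since cochains alternate.

  A morphism of complexes induces a linear map on cohomology because it sends coboundaries to
  coboundaries; this is proved for arbitrary morphisms.
\<close>

section \<open>Signed sums over the ways of taking entries out of a list\<close>

text \<open>
  The alternating sum of \<open>(-1)\<^sup>i F x\<^sub>i (x\<^sub>0, \<dots>, x\<^sub>i\<^sub>-\<^sub>1, x\<^sub>i\<^sub>+\<^sub>1, \<dots>)\<close>, in the form of a recursion on the
  list so that identities between nested sums follow by induction, without index arithmetic.
\<close>

primrec pick :: "('a \<Rightarrow> 'a list \<Rightarrow> 'v::ab_group_add) \<Rightarrow> 'a list \<Rightarrow> 'v" where
  "pick F [] = 0"
| "pick F (x # xs) = F x xs - pick (\<lambda>y ys. F y (x # ys)) xs"

text \<open>
  The sum of \<open>(-1)\<^sup>i\<^sup>+\<^sup>j F x\<^sub>i x\<^sub>j\<close> over \<open>i < j\<close>, again applied to the list of the remaining entries. The first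
  entry either stays or is \<open>x\<^sub>i\<close>; in the latter case the parity of \<open>i + j\<close> is opposite to that of the
  position of \<open>x\<^sub>j\<close> in the tail.
\<close>

primrec pick_pair :: "('a \<Rightarrow> 'a \<Rightarrow> 'a list \<Rightarrow> 'v::ab_group_add) \<Rightarrow> 'a list \<Rightarrow> 'v" where
  "pick_pair F [] = 0"
| "pick_pair F (x # xs) = pick_pair (\<lambda>y z zs. F y z (x # zs)) xs - pick (F x) xs"

lemma pick_add:
  "pick (\<lambda>x ys. F x ys + G x ys) xs = pick F xs + pick G xs"
  by (induction xs arbitrary: F G) simp_all

lemma pick_additive:
  assumes "additive h"
  shows "h (pick F xs) = pick (\<lambda>x ys. h (F x ys)) xs"
  by (induction xs arbitrary: F) (simp_all add: additive.zero[OF assms] additive.diff[OF assms])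

lemma additive_uminus: "additive (uminus :: 'v::ab_group_add \<Rightarrow> 'v)"
  by (simp add: additive_def)

lemmas pick_minus = pick_additive[OF additive_uminus, symmetric]

lemma pick_diff:
  "pick (\<lambda>x ys. F x ys - G x ys) xs = pick F xs - pick G xs"
  using pick_add[of F "\<lambda>x ys. - G x ys" xs] by (simp add: pick_minus)

lemma pick_pair_add:
  "pick_pair (\<lambda>x y zs. F x y zs + G x y zs) xs = pick_pair F xs + pick_pair G xs"
  by (induction xs arbitrary: F G) (simp_all add: pick_add)

lemma pick_zero [simp]: "pick (\<lambda>x ys. 0) xs = 0"
  by (induction xs) simp_all

lemma pick_pair_zero [simp]: "pick_pair (\<lambda>x y zs. 0) xs = 0"
  by (induction xs) simp_all

lemma pick_pair_additive:
  assumes "additive h"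
  shows "h (pick_pair F xs) = pick_pair (\<lambda>x y zs. h (F x y zs)) xs"
  by (induction xs arbitrary: F)
    (simp_all add: additive.zero[OF assms] additive.diff[OF assms] pick_additive[OF assms])

lemmas pick_pair_minus = pick_pair_additive[OF additive_uminus, symmetric]

lemma pick_pair_diff:
  "pick_pair (\<lambda>x y zs. F x y zs - G x y zs) xs = pick_pair F xs - pick_pair G xs"
  using pick_pair_add[of F "\<lambda>x y zs. - G x y zs" xs] by (simp add: pick_pair_minus)

lemma pick_map:
  "pick F (map h xs) = pick (\<lambda>x ys. F (h x) (map h ys)) xs"
  by (induction xs arbitrary: F) simp_all

lemma pick_pair_map:
  "pick_pair F (map h xs) = pick_pair (\<lambda>x y zs. F (h x) (h y) (map h zs)) xs"
  by (induction xs arbitrary: F) (simp_all add: pick_map)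

lemma pick_eq_0:
  assumes "\<And>x ys. Suc (length ys) = length xs \<Longrightarrow> F x ys = 0"
  shows "pick F xs = 0"
  using assms by (induction xs arbitrary: F) simp_all

lemma pick_pair_eq_0:
  assumes "\<And>x y zs. Suc (Suc (length zs)) = length xs \<Longrightarrow> F x y zs = 0"
  shows "pick_pair F xs = 0"
  using assms by (induction xs arbitrary: F) (simp_all add: pick_eq_0)

text \<open>
  A pair \<open>i < j\<close> is picked in two orders. If \<open>x\<^sub>j\<close> goes first, the sign is \<open>(-1)\<^sup>i\<^sup>+\<^sup>j\<close>; if \<open>x\<^sub>i\<close> goes first,
  the position of \<open>x\<^sub>j\<close> drops by one and the sign is opposite.
\<close>

lemma pick_pick:
  "pick (\<lambda>x. pick (F x)) xs = pick_pair (\<lambda>x y zs. F y x zs - F x y zs) xs"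
  by (induction xs arbitrary: F) (simp_all add: pick_diff)

lemma pick_swap:
  "pick (\<lambda>x. pick (F x)) xs = - pick (\<lambda>x. pick (\<lambda>y. F y x)) xs"
  unfolding pick_pick by (simp flip: pick_pair_minus)

text \<open>
  Taking an entry out before instead of after another one costs a sign; before instead of after a
  pair, it costs none.
\<close>

lemma pick_pick_pair:
  "pick (\<lambda>x. pick_pair (F x)) xs = pick_pair (\<lambda>y z. pick (\<lambda>x. F x y z)) xs"
proof (induction xs arbitrary: F)
  case (Cons a xs)
  then show ?case
    using pick_swap[of "\<lambda>x. F x a" xs] by (simp add: pick_diff pick_pair_diff)
qed simp

text \<open>
  Three entries \<open>a\<close>, \<open>y\<close>, \<open>z\<close> occur in the nested sum with each of them as the single pick; by
  skewness in the first two arguments, these three terms form a cyclic sum.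
\<close>

lemma pick_pair_cyclic:
  assumes "\<And>x y z zs. J x y z zs = - J y x z zs"
    and "\<And>x y z zs. J x y z zs + J y z x zs + J z x y zs = 0"
  shows "pick_pair (\<lambda>x y. pick (J x y)) xs = 0"
  using assms
proof (induction xs arbitrary: J)
  case Nil
  show ?case by simp
next
  case (Cons a xs)
  have "pick_pair (\<lambda>x y zs. J x y a zs) xs
      - pick_pair (\<lambda>y z zs. J a z y zs - J a y z zs) xs
      = pick_pair (\<lambda>x y zs. J x y a zs + J y a x zs + J a x y zs) xs"
    unfolding pick_pair_diff[symmetric] using Cons.prems(1)[of a] by (simp add: algebra_simps)
  also have "\<dots> = 0" by (simp only: Cons.prems(2) pick_pair_zero)
  finally have "pick_pair (\<lambda>x y zs. J x y a zs) xs = pick (\<lambda>y. pick (J a y)) xs"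
    by (simp add: pick_pick)
  moreover have "pick_pair (\<lambda>x y. pick (\<lambda>z zs. J x y z (a # zs))) xs = 0"
    by (rule Cons.IH) (rule Cons.prems)+
  ultimately show ?case
    by (simp add: pick_pair_diff)
qed

text \<open>
  Two disjoint pairs can be taken out in either order with the same sign, so the two orders cancel.
\<close>

lemma pick_pair_skew:
  assumes "\<And>x y z w zs. K x y z w zs = - K z w x y zs"
  shows "pick_pair (\<lambda>x y. pick_pair (K x y)) xs = 0"
  using assms
proof (induction xs arbitrary: K)
  case Nil
  show ?case by simp
next
  case (Cons a xs)
  have "pick (\<lambda>y. pick_pair (K a y)) xs = - pick_pair (\<lambda>z w. pick (K z w a)) xs"
    unfolding pick_pick_pair pick_minus[symmetric] pick_pair_minus[symmetric]
    using Cons.prems[of a] by presburger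
  moreover have "pick_pair (\<lambda>x y. pick_pair (\<lambda>z w zs. K x y z w (a # zs))) xs = 0"
    by (rule Cons.IH) (rule Cons.prems)
  ultimately show ?case
    by (simp add: pick_pair_diff)
qed

text \<open>
  The terms that pick neither of the two neighbours change sign by hypothesis. The terms that
  pick one of them trade places, and the positions of the two differ by one.
\<close>

lemma pick_exchange:
  assumes "\<And>z as x y bs. F z (as @ x # y # bs) = - F z (as @ y # x # bs)"
  shows "pick F (as @ x # y # bs) = - pick F (as @ y # x # bs)"
  using assms
proof (induction as arbitrary: F)
  case Nil
  have "(\<lambda>z zs. F z (x # y # zs)) = (\<lambda>z zs. - F z (y # x # zs))"
    using Nil[of _ "[]" x y] by (simp only: append_Nil)
  then have "pick (\<lambda>z zs. F z (x # y # zs)) bs = - pick (\<lambda>z zs. F z (y # x # zs)) bs"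
    by (simp only: pick_minus)
  then show ?case by simp
next
  case (Cons a as)
  have "pick (\<lambda>z zs. F z (a # zs)) (as @ x # y # bs)
      = - pick (\<lambda>z zs. F z (a # zs)) (as @ y # x # bs)"
    by (rule Cons.IH) (rule Cons.prems[of _ "a # _", unfolded append_Cons])
  then show ?case
    by (simp add: Cons.prems[of a as x y bs])
qed

lemma pick_pair_exchange:
  assumes "\<And>z w zs. F z w zs = - F w z zs"
    and "\<And>z w as x y bs. F z w (as @ x # y # bs) = - F z w (as @ y # x # bs)"
  shows "pick_pair F (as @ x # y # bs) = - pick_pair F (as @ y # x # bs)"
  using assms
proof (induction as arbitrary: F)
  case Nil
  have "(\<lambda>z w zs. F z w (x # y # zs)) = (\<lambda>z w zs. - F z w (y # x # zs))"
    using Nil(2)[of _ _ "[]" x y] by (simp only: append_Nil)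
  then have "pick_pair (\<lambda>z w zs. F z w (x # y # zs)) bs
      = - pick_pair (\<lambda>z w zs. F z w (y # x # zs)) bs"
    by (simp only: pick_pair_minus)
  then show ?case
    using Nil(1)[of x y bs] by simp
next
  case (Cons a as)
  have "pick_pair (\<lambda>z w zs. F z w (a # zs)) (as @ x # y # bs)
      = - pick_pair (\<lambda>z w zs. F z w (a # zs)) (as @ y # x # bs)"
    by (rule Cons.IH) (rule Cons.prems(1), rule Cons.prems(2)[of _ _ "a # _", unfolded append_Cons])
  moreover have "pick (F a) (as @ x # y # bs) = - pick (F a) (as @ y # x # bs)"
    by (rule pick_exchange) (rule Cons.prems)
  ultimately show ?case by simp
qed

context vector_space_pair
begin

lemma linear_pick_parameter:
  assumes "\<And>z zs. Vector_Spaces.linear s1 s2 (\<lambda>x. F x z zs)"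
  shows "Vector_Spaces.linear s1 s2 (\<lambda>x. pick (F x) xs)"
  using assms
  by (induction xs arbitrary: F) (simp_all add: linear_zero linear_compose_sub)

text \<open>
  This and its counterpart for pairs supply the multilinearity of coboundaries.
\<close>

lemma linear_pick:
  assumes "\<And>zs. Vector_Spaces.linear s1 s2 (\<lambda>x. F x zs)"
    and "\<And>z as bs. Vector_Spaces.linear s1 s2 (\<lambda>x. F z (as @ x # bs))"
  shows "Vector_Spaces.linear s1 s2 (\<lambda>x. pick F (as @ x # bs))"
  using assms
proof (induction as arbitrary: F)
  case Nil
  then show ?case
    using Nil(2)[of _ "[]"] by (simp add: linear_compose_sub linear_pick_parameter)
next
  case (Cons a as)
  have "Vector_Spaces.linear s1 s2 (\<lambda>x. pick (\<lambda>z zs. F z (a # zs)) (as @ x # bs))"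
    by (rule Cons.IH) (rule Cons.prems(1), use Cons.prems(2)[of _ "a # _"] in simp)
  then show ?case
    using Cons.prems(2) by (simp add: linear_compose_sub)
qed

lemma linear_pick_pair_parameter:
  assumes "\<And>z w zs. Vector_Spaces.linear s1 s2 (\<lambda>x. F x z w zs)"
  shows "Vector_Spaces.linear s1 s2 (\<lambda>x. pick_pair (F x) xs)"
  using assms
  by (induction xs arbitrary: F)
    (simp_all add: linear_zero linear_compose_sub linear_pick_parameter)

lemma linear_pick_pair:
  assumes "\<And>z zs. Vector_Spaces.linear s1 s2 (\<lambda>x. F x z zs)"
    and "\<And>z zs. Vector_Spaces.linear s1 s2 (\<lambda>x. F z x zs)"
    and "\<And>z w as bs. Vector_Spaces.linear s1 s2 (\<lambda>x. F z w (as @ x # bs))"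
  shows "Vector_Spaces.linear s1 s2 (\<lambda>x. pick_pair F (as @ x # bs))"
  using assms
proof (induction as arbitrary: F)
  case Nil
  then show ?case
    using Nil(3)[of _ _ "[]"]
    by (simp add: linear_compose_sub linear_pick_parameter linear_pick_pair_parameter)
next
  case (Cons a as)
  have "Vector_Spaces.linear s1 s2 (\<lambda>x. pick_pair (\<lambda>z w zs. F z w (a # zs)) (as @ x # bs))"
    by (rule Cons.IH) (rule Cons.prems(1), rule Cons.prems(2), use Cons.prems(3)[of _ _ "a # _"] in simp)
  moreover have "Vector_Spaces.linear s1 s2 (\<lambda>x. pick (F a) (as @ x # bs))"
    by (rule linear_pick) (rule Cons.prems)+
  ultimately show ?case
    by (simp add: linear_compose_sub)
qed

end

context vector_space
begin

text \<open>
  The closed forms connect the recursive sums with the formula that defines the coboundary.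
\<close>

lemma pick_eq_sum:
  "pick F xs = (\<Sum>i<length xs. scale ((-1) ^ i) (F (xs ! i) (nths xs (- {i}))))"
proof (induction xs arbitrary: F)
  case (Cons x xs)
  have "{j. Suc j \<in> - {0}} = UNIV" "\<And>i. {j. Suc j \<in> - {Suc i}} = - {i}" by auto
  then show ?case
    by (simp add: Cons sum.lessThan_Suc_shift nths_Cons nths_all sum_negf del: sum.lessThan_Suc)
qed simp

lemma pick_pair_eq_sum:
  "pick_pair F xs = (\<Sum>j<length xs. \<Sum>i<j.
    scale ((-1) ^ (i + j)) (F (xs ! i) (xs ! j) (nths xs (- {i, j}))))"
proof (induction xs arbitrary: F)
  case (Cons x xs)
  have "\<And>i. {j. Suc j \<in> - {0, Suc i}} = - {i}" "\<And>i k. {j. Suc j \<in> - {Suc i, Suc k}} = - {i, k}" by auto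
  then show ?case
    by (simp add: Cons pick_eq_sum sum.lessThan_Suc_shift nths_Cons sum_subtractf del: sum.lessThan_Suc)
qed simp

end

section \<open>Alternating maps\<close>

text \<open>
  Changing sign under exchange of neighbours is easier to transport through signed sums than
  vanishing on repeated arguments. It implies the latter because equal entries can be moved next to
  each other, and \<open>v = - v\<close> forces \<open>v = 0\<close> over a field of characteristic zero.
\<close>

lemma alternating_mapI:
  fixes s :: "'k::field_char_0 \<Rightarrow> 'g::ab_group_add \<Rightarrow> 'g"
    and sv :: "'k \<Rightarrow> 'v::ab_group_add \<Rightarrow> 'v"
  assumes lin: "\<And>as bs. Vector_Spaces.linear s sv (\<lambda>x. f (as @ x # bs))"
    and exchange: "\<And>as x y bs. f (as @ x # y # bs) = - f (as @ y # x # bs)"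
    and length: "\<And>xs. length xs \<noteq> n \<Longrightarrow> f xs = 0"
  shows "alternating_map s sv n f"
proof -
  interpret V: vector_space sv
    using lin by (simp add: Vector_Spaces.linear_iff)
  have two: "v = 0" if "v = - v" for v :: 'v
  proof -
    have "sv 2 v = 0"
      using that V.scale_left_distrib[of 1 1 v] by (simp add: eq_neg_iff_add_eq_0)
    then show ?thesis by simp
  qed
  have repeated: "f (as @ x # bs @ x # cs) = 0" for as x bs cs
  proof (induction bs arbitrary: as)
    case Nil
    show ?case using exchange[of as x x cs] two by simp
  next
    case (Cons b bs)
    show ?case using exchange[of as x b "bs @ x # cs"] Cons[of "as @ [b]"] by simp
  qed
  have "f xs = 0" if "length xs = n" "i < j" "j < n" "xs ! i = xs ! j" for xs i j
  proof -
    define as where "as = take i xs"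
    define bs where "bs = drop (Suc i) xs"
    have "bs ! (j - Suc i) = xs ! i" "j - Suc i < length bs"
      using that by (simp_all add: bs_def)
    then obtain ds cs where "bs = ds @ xs ! i # cs"
      by (metis id_take_nth_drop)
    moreover have "xs = as @ xs ! i # bs"
      unfolding as_def bs_def using that by (intro id_take_nth_drop) simp
    ultimately show ?thesis by (metis repeated)
  qed
  then show ?thesis
    unfolding alternating_map_def using lin length by (simp add: upd_conv_take_nth_drop)
qed

context
  fixes s :: "'k::field_char_0 \<Rightarrow> 'g::ab_group_add \<Rightarrow> 'g"
    and sv :: "'k \<Rightarrow> 'v::ab_group_add \<Rightarrow> 'v"
    and n :: nat and f :: "'g list \<Rightarrow> 'v"
  assumes spaces: "vector_space_pair s sv"
    and alternating: "alternating_map s sv n f"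
begin

lemma alternating_map_length: "length xs \<noteq> n \<Longrightarrow> f xs = 0"
  using alternating by (simp add: alternating_map_def)

lemma alternating_map_linear: "Vector_Spaces.linear s sv (\<lambda>x. f (as @ x # bs))"
proof (cases "length (as @ 0 # bs) = n")
  case True
  then have "Vector_Spaces.linear s sv (\<lambda>x. f ((as @ 0 # bs)[length as := x]))"
    using alternating unfolding alternating_map_def
    by (metis length_append length_Cons add_Suc_right less_add_Suc1)
  then show ?thesis by simp
next
  case False
  then have "f (as @ x # bs) = 0" for x
    by (simp add: alternating_map_length)
  then show ?thesis
    using vector_space_pair.linear_zero[OF spaces] by simp
qed

text \<open>
  The converse is polarisation: expand the value zero at \<open>(x + y, x + y)\<close>.
\<close>

lemma alternating_map_exchange: "f (as @ x # y # bs) = - f (as @ y # x # bs)"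
proof (cases "length (as @ x # y # bs) = n")
  case True
  have repeated: "f (as @ z # z # bs) = 0" for z
  proof -
    have "length (as @ z # z # bs) = n" "Suc (length as) < n" using True by simp_all
    moreover have "(as @ z # z # bs) ! length as = (as @ z # z # bs) ! Suc (length as)"
      by (simp add: nth_append)
    ultimately show ?thesis
      using alternating unfolding alternating_map_def by blast
  qed
  have left: "f (as @ (u + v) # w # bs) = f (as @ u # w # bs) + f (as @ v # w # bs)" for u v w
    using alternating_map_linear[of as "w # bs"] by (simp add: Vector_Spaces.linear_iff)
  have right: "f (as @ w # (u + v) # bs) = f (as @ w # u # bs) + f (as @ w # v # bs)" for u v w
    using alternating_map_linear[of "as @ [w]" bs] by (simp add: Vector_Spaces.linear_iff)
  have "f (as @ x # y # bs) + f (as @ y # x # bs) = 0"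
    using repeated[of "x + y"] unfolding left right by (simp add: repeated add.commute)
  then show ?thesis by (simp add: eq_neg_iff_add_eq_0)
qed (simp add: alternating_map_length)

end

lemma vector_space_fun_scale: "vector_space sv \<Longrightarrow> vector_space (fun_scale sv)"
  by (simp add: vector_space_def fun_scale_def fun_eq_iff)

section \<open>The Hom-Lie cochain complex\<close>

context hom_lie_representation
begin

sublocale pair: vector_space_pair s sv
  by unfold_locales

abbreviation "cochains \<equiv> hom_cochains s al sv be"
abbreviation "coboundary \<equiv> hom_coboundary br al sv act"

lemma bracket_minus_left: "br (- x) y = - br x y"
  using alg.bracket_linear_left[of y]
    vector_space_pair.linear_neg[OF _ alg.bracket_linear_left]
  by (simp add: Vector_Spaces.linear_iff vector_space_pair_def)

lemma act_simps:
  "act (x + y) v = act x v + act y v" "act x (v + w) = act x v + act x w"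
  "act x (- v) = - act x v" "act x 0 = 0" "act x (sv c v) = sv c (act x v)"
  using act_linear_left[of v] act_linear_right[of x]
    vector_space_pair.linear_neg[OF _ act_linear_right]
    vector_space_pair.linear_0[OF _ act_linear_right]
  by (simp_all add: Vector_Spaces.linear_iff vector_space_pair_def)

lemma twist_simps:
  "be (v + w) = be v + be w" "be (sv c v) = sv c (be v)" "be 0 = 0"
  using linear_rep_twist vector_space_pair.linear_0[OF _ linear_rep_twist]
  by (simp_all add: Vector_Spaces.linear_iff vector_space_pair_def)

lemma additive_act: "additive (act x)" and additive_be: "additive be"
  by (simp_all add: additive_def act_simps twist_simps)

lemma linear_funpow_twist: "Vector_Spaces.linear s s (al ^^ m)"
proof (induction m)
  case 0
  show ?case by (simp add: alg.linear_ident id_def)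
next
  case (Suc m)
  then show ?case using Vector_Spaces.linear_compose[OF Suc alg.linear_twist] by (simp add: comp_def)
qed

lemma funpow_twist_bracket: "(al ^^ m) (br x y) = br ((al ^^ m) x) ((al ^^ m) y)"
  by (induction m) (simp_all add: alg.bracket_twist)

lemma cochain_alternating: "f \<in> cochains n \<Longrightarrow> 0 < n \<Longrightarrow> alternating_map s sv n f"
  by (simp add: hom_cochains_def)

lemmas cochain_length = alternating_map_length[OF pair.vector_space_pair_axioms cochain_alternating]
lemmas cochain_linear = alternating_map_linear[OF pair.vector_space_pair_axioms cochain_alternating]
lemmas cochain_exchange = alternating_map_exchange[OF pair.vector_space_pair_axioms cochain_alternating]

lemma cochain_twist: "f \<in> cochains n \<Longrightarrow> 0 < n \<Longrightarrow> be (f xs) = f (map al xs)"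
  by (cases "length xs = n")
    (simp_all add: cochain_length twist_simps, simp add: hom_cochains_def)

text \<open>
  Since a cochain vanishes on lists of the wrong length, this holds for lists of all lengths,
  which frees the computations below from side conditions on lengths.
\<close>

lemma coboundary_eq_pick:
  assumes "f \<in> cochains n" "0 < n"
  shows "coboundary n f = (\<lambda>xs.
    pick (\<lambda>x ys. act ((al ^^ (n - 1)) x) (f ys)) xs
    + pick_pair (\<lambda>x y zs. f (br x y # map al zs)) xs)"
proof
  fix xs
  show "coboundary n f xs =
    pick (\<lambda>x ys. act ((al ^^ (n - 1)) x) (f ys)) xs
    + pick_pair (\<lambda>x y zs. f (br x y # map al zs)) xs"
  proof (cases "length xs = Suc n")
    case True
    then show ?thesis
      using \<open>0 < n\<close> unfolding hom_coboundary_def rep.pick_eq_sum rep.pick_pair_eq_sum by simp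
  next
    case False
    then show ?thesis
      by (simp add: hom_coboundary_def cochain_length[OF assms] act_simps twist_simps pick_eq_0 pick_pair_eq_0)
  qed
qed

lemma cochain_Cons:
  assumes "f \<in> cochains n" "0 < n"
  shows "Vector_Spaces.linear s sv (\<lambda>x. f (x # xs))"
    and "f (x # y # xs) = - f (y # x # xs)"
    and "f ((x + y) # xs) = f (x # xs) + f (y # xs)"
    and "f ((- x) # xs) = - f (x # xs)"
    and "f (0 # xs) = 0"
proof -
  show l: "Vector_Spaces.linear s sv (\<lambda>x. f (x # xs))"
    using cochain_linear[OF assms, of "[]"] by simp
  show "f (x # y # xs) = - f (y # x # xs)"
    by (rule cochain_exchange[OF assms, of "[]", unfolded append_Nil])
  show "f ((x + y) # xs) = f (x # xs) + f (y # xs)"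
    using l by (simp add: Vector_Spaces.linear_iff)
  show "f ((- x) # xs) = - f (x # xs)" using pair.linear_neg[OF l] .
  show "f (0 # xs) = 0" using pair.linear_0[OF l] .
qed

lemma coboundary_alternating:
  assumes f: "f \<in> cochains n" and n: "0 < n"
  shows "alternating_map s sv (Suc n) (coboundary n f)"
proof (rule alternating_mapI)
  note lin = cochain_Cons(1)[OF f n]
  fix as bs :: "'g list"
  have "Vector_Spaces.linear s sv (\<lambda>x. act ((al ^^ (n - 1)) x) v)" for v
    using Vector_Spaces.linear_compose[OF linear_funpow_twist act_linear_left] by (simp add: comp_def)
  moreover have "Vector_Spaces.linear s sv (\<lambda>x. act z (f (as @ x # bs)))" for z as bs
    using Vector_Spaces.linear_compose[OF cochain_linear[OF f n] act_linear_right] by (simp add: comp_def)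
  ultimately have 1: "Vector_Spaces.linear s sv
      (\<lambda>x. pick (\<lambda>x ys. act ((al ^^ (n - 1)) x) (f ys)) (as @ x # bs))"
    by (rule pair.linear_pick)
  have "Vector_Spaces.linear s sv (\<lambda>x. f (br x z # map al zs))"
    "Vector_Spaces.linear s sv (\<lambda>x. f (br z x # map al zs))" for z zs
    using Vector_Spaces.linear_compose[OF alg.bracket_linear_left lin]
      Vector_Spaces.linear_compose[OF alg.bracket_linear_right lin] by (simp_all add: comp_def)
  moreover have "Vector_Spaces.linear s sv (\<lambda>x. f (br z w # map al (as @ x # bs)))" for z w as bs
    using Vector_Spaces.linear_compose[OF alg.linear_twist
        cochain_linear[OF f n, of "br z w # map al as" "map al bs"]] by (simp add: comp_def)
  ultimately have 2: "Vector_Spaces.linear s sv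
      (\<lambda>x. pick_pair (\<lambda>x y zs. f (br x y # map al zs)) (as @ x # bs))"
    by (rule pair.linear_pick_pair)
  show "Vector_Spaces.linear s sv (\<lambda>x. coboundary n f (as @ x # bs))"
    unfolding coboundary_eq_pick[OF f n]
    using 1 2 by (rule pair.linear_compose_add)
next
  fix as x y bs
  have 1: "pick (\<lambda>x ys. act ((al ^^ (n - 1)) x) (f ys)) (as @ x # y # bs)
    = - pick (\<lambda>x ys. act ((al ^^ (n - 1)) x) (f ys)) (as @ y # x # bs)"
    by (rule pick_exchange) (subst cochain_exchange[OF f n], rule act_simps)
  have 2: "pick_pair (\<lambda>x y zs. f (br x y # map al zs)) (as @ x # y # bs)
    = - pick_pair (\<lambda>x y zs. f (br x y # map al zs)) (as @ y # x # bs)"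
  proof (rule pick_pair_exchange)
    show "f (br z w # map al zs) = - f (br w z # map al zs)" for z w zs
      by (subst alg.bracket_skew) (rule cochain_Cons[OF f n])
    show "f (br z w # map al (as @ x # y # bs)) = - f (br z w # map al (as @ y # x # bs))"
      for z w as x y bs
      using cochain_exchange[OF f n, of "br z w # map al as" "al x" "al y" "map al bs"]
      by (simp only: append_Cons map_append list.map)
  qed
  show "coboundary n f (as @ x # y # bs) = - coboundary n f (as @ y # x # bs)"
    unfolding coboundary_eq_pick[OF f n] using 1 2 by simp
qed (simp add: hom_coboundary_def)

lemma coboundary_twist:
  assumes f: "f \<in> cochains n" and n: "0 < n"
  shows "be (coboundary n f xs) = coboundary n f (map al xs)"
  unfolding coboundary_eq_pick[OF f n]
  by (simp add: pick_map pick_pair_map act_simps twist_simps pick_additive[OF additive_be]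
      pick_pair_additive[OF additive_be] act_twist cochain_twist[OF f n] alg.bracket_twist
      funpow_swap1 comp_def)

lemma coboundary_zero_cochain:
  assumes "f \<in> cochains 0"
  shows "coboundary 0 f \<in> cochains 1"
proof -
  obtain v where v: "be v = v" "f = const_cochain v"
    using assms by (auto simp: hom_cochains_def)
  have eq: "coboundary 0 f = (\<lambda>xs. if length xs = 1 then act (xs ! 0) v else 0)"
    by (simp add: v hom_coboundary_def const_cochain_def fun_eq_iff)
  have "alternating_map s sv 1 (coboundary 0 f)"
  proof (rule alternating_mapI)
    show "Vector_Spaces.linear s sv (\<lambda>x. coboundary 0 f (as @ x # bs))" for as bs
      by (cases "as = [] \<and> bs = []") (auto simp: eq act_linear_left pair.linear_zero)
  qed (auto simp: eq)
  moreover have "be (coboundary 0 f xs) = coboundary 0 f (map al xs)" if "length xs = 1" for xs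
    unfolding eq using that by (simp add: act_twist v)
  ultimately show ?thesis
    by (simp add: hom_cochains_def)
qed

lemma coboundary_cochain:
  assumes "f \<in> cochains n"
  shows "coboundary n f \<in> cochains (Suc n)"
  using assms coboundary_zero_cochain coboundary_alternating coboundary_twist
  by (cases "n = 0") (simp_all add: hom_cochains_def)

text \<open>
  Expanding the square gives terms with two actions, with an action and a bracket, with nested
  brackets and with two disjoint brackets. These groups cancel separately, where the action of a
  bracket, \<open>\<alpha>\<^sup>n\<^sup>-\<^sup>1 [x, y] \<bullet> f(\<alpha> zs)\<close>, belongs to the terms with two actions. This is where \<open>\<beta> \<circ> f = f \<circ> \<alpha>\<close> enters: the
  axiom for the action of a bracket needs a vector in the image of \<open>\<beta>\<close>.
\<close>

lemma coboundary_squared: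
  assumes f: "f \<in> cochains n" and n: "0 < n"
  shows "coboundary (Suc n) (coboundary n f) = 0"
proof
  fix xs
  note df = coboundary_cochain[OF f]
  define a where "a m x = act ((al ^^ m) x)" for m x
  have act_act: "pick (\<lambda>x. pick (\<lambda>y zs. a n x (a (n - 1) y (f zs)))) xs
      + pick_pair (\<lambda>x y zs. a (n - 1) (br x y) (f (map al zs))) xs = 0"
  proof -
    have "a (n - 1) (br x y) (f (map al zs))
        = a n x (a (n - 1) y (f zs)) - a n y (a (n - 1) x (f zs))" for x y zs
      using n act_bracket[of "(al ^^ (n - 1)) x" "(al ^^ (n - 1)) y" "f zs"]
      by (cases n) (simp_all add: a_def funpow_twist_bracket cochain_twist[OF f])
    then show ?thesis
      by (simp add: pick_pick flip: pick_pair_add)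
  qed
  \<comment> \<open>The two mixed groups: the sides of this equation occur in the square with opposite signs.\<close>
  have act_bracket_terms: "pick (\<lambda>x. pick_pair (\<lambda>y z zs. a n x (f (br y z # map al zs)))) xs
      = pick_pair (\<lambda>x y. pick (\<lambda>z zs. a n z (f (br x y # map al zs)))) xs"
    by (rule pick_pick_pair)
  have jacobi: "pick_pair (\<lambda>x y. pick (\<lambda>z zs. f (br (br x y) (al z) # map al (map al zs)))) xs = 0"
  proof (rule pick_pair_cyclic)
    show "f (br (br x y) (al z) # map al (map al zs)) =
        - f (br (br y x) (al z) # map al (map al zs))" for x y z zs
    proof -
      have "br (br x y) w = - br (br y x) w" for w
        using alg.bracket_skew[of x y] by (metis bracket_minus_left)
      then show ?thesis by (simp only: cochain_Cons(4)[OF f n])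
    qed
    show "f (br (br x y) (al z) # map al (map al zs)) + f (br (br y z) (al x) # map al (map al zs)) +
        f (br (br z x) (al y) # map al (map al zs)) = 0" for x y z zs
      by (simp only: cochain_Cons(3)[OF f n, symmetric] alg.hom_jacobi cochain_Cons(5)[OF f n])
  qed
  \<comment> \<open>Two disjoint brackets; \<open>\<alpha> [x, y] = [\<alpha> x, \<alpha> y]\<close> makes them symmetric.\<close>
  have exchange: "pick_pair (\<lambda>x y. pick_pair (\<lambda>z w zs.
      f (br (al z) (al w) # al (br x y) # map al (map al zs)))) xs = 0"
    unfolding alg.bracket_twist by (rule pick_pair_skew) (rule cochain_Cons(2)[OF f n])
  \<comment> \<open>In the argument list \<open>[x, y] # \<alpha> zs\<close> the bracket is either picked or left in place.\<close>
  have "coboundary n f (br x y # map al zs) =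
      a (n - 1) (br x y) (f (map al zs))
      - pick (\<lambda>z zs. a n z (f (br x y # map al zs))) zs
      - pick (\<lambda>z zs. f (br (br x y) (al z) # map al (map al zs))) zs
      + pick_pair (\<lambda>z w zs. f (br (al z) (al w) # al (br x y) # map al (map al zs))) zs" for x y zs
    using n unfolding coboundary_eq_pick[OF f n]
    by (cases n) (simp_all add: a_def pick_map pick_pair_map funpow_swap1)
  moreover have "a n x (coboundary n f ys) =
      pick (\<lambda>y zs. a n x (a (n - 1) y (f zs))) ys
      + pick_pair (\<lambda>y z zs. a n x (f (br y z # map al zs))) ys" for x ys
    unfolding coboundary_eq_pick[OF f n]
    by (simp add: a_def act_simps pick_additive[OF additive_act] pick_pair_additive[OF additive_act])
  ultimately show "coboundary (Suc n) (coboundary n f) xs = 0 xs"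
    unfolding coboundary_eq_pick[OF df zero_less_Suc] diff_Suc_1
    using act_act act_bracket_terms jacobi exchange
    by (simp add: pick_add pick_pair_add pick_pair_diff add.assoc a_def[symmetric])
qed


lemma coboundary_add: "coboundary n (f + g) = coboundary n f + coboundary n g"
  by (auto simp: fun_eq_iff hom_coboundary_def act_simps rep.scale_right_distrib sum.distrib
      add.assoc add.left_commute)

lemma coboundary_scale: "coboundary n (fun_scale sv c f) = fun_scale sv c (coboundary n f)"
  by (auto simp: fun_eq_iff hom_coboundary_def fun_scale_def act_simps rep.scale_right_distrib
      rep.scale_sum_right mult.commute)

lemma additive_coboundary: "additive (coboundary n)"
  by (simp add: additive_def coboundary_add)

lemmas coboundary_0 = additive.zero[OF additive_coboundary]
lemmas coboundary_sum = additive.sum[OF additive_coboundary]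

lemma subspace_cochains: "module.subspace (fun_scale sv) (cochains n)"
proof -
  interpret cochain: vector_space "fun_scale sv :: 'k \<Rightarrow> ('g list \<Rightarrow> 'v) \<Rightarrow> _"
    by (rule vector_space_fun_scale) (rule rep.vector_space_axioms)
  show ?thesis
  proof (cases "n = 0")
    case True
    have "const_cochain 0 = (0 :: 'g list \<Rightarrow> 'v)"
      "\<And>v w. const_cochain v + const_cochain w = (const_cochain (v + w) :: 'g list \<Rightarrow> 'v)"
      "\<And>c v. fun_scale sv c (const_cochain v) = (const_cochain (sv c v) :: 'g list \<Rightarrow> 'v)"
      by (simp_all add: fun_eq_iff const_cochain_def fun_scale_def)
    then show ?thesis
      using True unfolding cochain.subspace_def hom_cochains_def
      by (auto simp: twist_simps image_iff) (metis twist_simps)+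
  next
    case False
    then show ?thesis
      unfolding cochain.subspace_def hom_cochains_def alternating_map_def
      by (simp add: fun_scale_def twist_simps pair.linear_zero pair.linear_compose_add
          pair.linear_compose_scale_right)
  qed
qed

lemma cochains_add: "f \<in> cochains n \<Longrightarrow> g \<in> cochains n \<Longrightarrow> f + g \<in> cochains n"
  and cochains_scale: "f \<in> cochains n \<Longrightarrow> fun_scale sv c f \<in> cochains n"
  and cochains_0: "0 \<in> cochains n"
  and cochains_sum: "(\<And>i. i \<in> A \<Longrightarrow> F i \<in> cochains n) \<Longrightarrow> (\<Sum>i\<in>A. F i) \<in> cochains n"
proof -
  interpret cochain: vector_space "fun_scale sv :: 'k \<Rightarrow> ('g list \<Rightarrow> 'v) \<Rightarrow> _"
    by (rule vector_space_fun_scale) (rule rep.vector_space_axioms)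
  note sub = subspace_cochains
  show "f \<in> cochains n \<Longrightarrow> g \<in> cochains n \<Longrightarrow> f + g \<in> cochains n"
    "f \<in> cochains n \<Longrightarrow> fun_scale sv c f \<in> cochains n"
    "0 \<in> cochains n"
    "(\<And>i. i \<in> A \<Longrightarrow> F i \<in> cochains n) \<Longrightarrow> (\<Sum>i\<in>A. F i) \<in> cochains n"
    using sub
    by (auto intro: cochain.subspace_add cochain.subspace_scale
        cochain.subspace_0 cochain.subspace_sum)
qed

lemma cochain_complex_hom: "cochain_complex (fun_scale sv) cochains coboundary"
  using vector_space_fun_scale[OF rep.vector_space_axioms]
  by (auto simp: cochain_complex_def cochain_complex_axioms_def linear_between_def
      subspace_cochains coboundary_cochain coboundary_add coboundary_scale coboundary_squared)

end

section \<open>The compatible cochain complex and the map to the complex of the sum\<close>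

locale compatible_representation =
  compatible_hom_lie_algebra s br1 br2 al + compatible_hom_lie_representation s br1 br2 al sv act1 act2 be
  for s :: "'k::field_char_0 \<Rightarrow> 'g::ab_group_add \<Rightarrow> 'g"
    and br1 br2 :: "'g \<Rightarrow> 'g \<Rightarrow> 'g" and al :: "'g \<Rightarrow> 'g"
    and sv :: "'k \<Rightarrow> 'v::ab_group_add \<Rightarrow> 'v"
    and act1 act2 :: "'g \<Rightarrow> 'v \<Rightarrow> 'v" and be :: "'v \<Rightarrow> 'v"
begin

sublocale rep1: hom_lie_representation s br1 al sv act1 be
  by (rule rep_1)

sublocale rep2: hom_lie_representation s br2 al sv act2 be
  by (rule rep_2)

lemma hom_lie_sum: "hom_lie_algebra s (br1 + br2) al"
proof -
  have "br1 + br2 = (\<lambda>x y. s 1 (br1 x y) + s 1 (br2 x y))"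
    by (simp add: fun_eq_iff)
  then show ?thesis using hom_lie_combination by metis
qed

text \<open>
  Expanding the bracket axiom for the sums gives the axioms of the two representations and, as the
  mixed terms, the compatibility condition.
\<close>

lemma representation_sum: "hom_lie_representation s (br1 + br2) al sv (act1 + act2) be"
  using hom_lie_sum rep1.rep.vector_space_axioms
proof (rule hom_lie_representation.intro)
  show "hom_lie_representation_axioms s (br1 + br2) al sv (act1 + act2) be"
  proof (rule hom_lie_representation_axioms.intro)
    show "Vector_Spaces.linear sv sv be" by (rule rep1.linear_rep_twist)
    show "Vector_Spaces.linear s sv (\<lambda>x. (act1 + act2) x v)" for v
      using rep1.pair.linear_compose_add[OF rep1.act_linear_left rep2.act_linear_left] by simp
    show "Vector_Spaces.linear sv sv (\<lambda>v. (act1 + act2) x v)" for x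
      using vector_space_pair.linear_compose_add[OF _ rep1.act_linear_right rep2.act_linear_right]
      by (simp add: vector_space_pair_def rep1.rep.vector_space_axioms)
    show "be ((act1 + act2) x v) = (act1 + act2) (al x) (be v)" for x v
      by (simp add: rep1.act_twist rep2.act_twist rep1.twist_simps)
    show "(act1 + act2) ((br1 + br2) x y) (be v)
        = (act1 + act2) (al x) ((act1 + act2) y v) - (act1 + act2) (al y) ((act1 + act2) x v)" for x y v
    proof -
      have "(act1 + act2) ((br1 + br2) x y) (be v)
          = act1 (br1 x y) (be v) + act2 (br2 x y) (be v)
            + (act2 (br1 x y) (be v) + act1 (br2 x y) (be v))"
        by (simp add: rep1.act_simps rep2.act_simps)
      then show ?thesis
        unfolding rep_compatible rep1.act_bracket rep2.act_bracket
        by (simp add: rep1.act_simps rep2.act_simps)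
    qed
  qed
qed

sublocale sum: hom_lie_representation s "br1 + br2" al sv "act1 + act2" be
  by (rule representation_sum)

abbreviation "ccochains \<equiv> chom_cochains s al sv act1 act2 be"
abbreviation "ccoboundary \<equiv> chom_coboundary br1 br2 al sv act1 act2"

lemma coboundary_sum_eq:
  assumes "f \<in> rep1.cochains n" "0 < n"
  shows "sum.coboundary n f = rep1.coboundary n f + rep2.coboundary n f"
  unfolding rep1.coboundary_eq_pick[OF assms] rep2.coboundary_eq_pick[OF assms]
    sum.coboundary_eq_pick[OF assms]
  by (simp add: fun_eq_iff pick_add pick_pair_add rep1.cochain_Cons[OF assms])

text \<open>
  Polarisation of \<open>(\<delta>\<^sub>1 + \<delta>\<^sub>2)\<^sup>2 = 0\<close>, which avoids a second computation with signed sums.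
\<close>

lemma coboundaries_anticommute:
  assumes f: "f \<in> rep1.cochains n" and n: "0 < n"
  shows "rep1.coboundary (Suc n) (rep2.coboundary n f)
    + rep2.coboundary (Suc n) (rep1.coboundary n f) = 0"
proof -
  have "0 = sum.coboundary (Suc n) (sum.coboundary n f)"
    using sum.coboundary_squared[OF f n] ..
  also have "\<dots> = rep1.coboundary (Suc n) (rep1.coboundary n f + rep2.coboundary n f)
      + rep2.coboundary (Suc n) (rep1.coboundary n f + rep2.coboundary n f)"
    using coboundary_sum_eq[OF sum.coboundary_cochain[OF f] zero_less_Suc]
    by (simp add: coboundary_sum_eq[OF f n])
  also have "\<dots> = rep1.coboundary (Suc n) (rep2.coboundary n f)
      + rep2.coboundary (Suc n) (rep1.coboundary n f)"
    by (simp add: rep1.coboundary_add rep2.coboundary_add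
        rep1.coboundary_squared[OF f n] rep2.coboundary_squared[OF f n])
  finally show ?thesis ..
qed

lemma ccochains_pos:
  "0 < n \<Longrightarrow> F \<in> ccochains n \<longleftrightarrow> (\<forall>i. F i \<in> rep1.cochains n \<and> (i \<notin> {1..n} \<longrightarrow> F i = 0))"
  using rep1.cochains_0 unfolding chom_cochains_def by auto

text \<open>
  Extending tuples by zero merges the first, middle and last entries of the compatible coboundary
  into one formula.
\<close>

lemma ccoboundary_pos:
  assumes "0 < n" "F \<in> ccochains n"
  shows "ccoboundary n F = (\<lambda>i. rep1.coboundary n (F i) + rep2.coboundary n (if i = 0 then 0 else F (i - 1)))"
proof
  fix i
  have "F j = 0" if "j = 0 \<or> n < j" for j
    using assms that by (auto simp: ccochains_pos)
  then show "ccoboundary n F i = rep1.coboundary n (F i) + rep2.coboundary n (if i = 0 then 0 else F (i - 1))"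
    using assms(1) unfolding chom_coboundary_def
    by (auto simp: rep1.coboundary_0 rep2.coboundary_0)
qed

lemma ccochains_zero:
  "F \<in> ccochains 0 \<longleftrightarrow>
    (\<exists>v. be v = v \<and> (\<forall>x. act1 x v = act2 x v) \<and> F = (\<lambda>i. if i = 0 then const_cochain v else 0))"
  by (auto simp: chom_cochains_def)

lemma subspace_ccochains: "module.subspace (fun_scale (fun_scale sv)) (ccochains n)"
proof -
  interpret cochain: vector_space "fun_scale (fun_scale sv) :: 'k \<Rightarrow> (nat \<Rightarrow> 'g list \<Rightarrow> 'v) \<Rightarrow> _"
    by (intro vector_space_fun_scale) (rule rep1.rep.vector_space_axioms)
  show ?thesis
  proof (cases "n = 0")
    case True
    show ?thesis
      unfolding cochain.subspace_def True
    proof (intro conjI ballI allI)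
      show "0 \<in> ccochains 0"
        unfolding ccochains_zero
        by (rule exI[of _ 0])
          (auto simp: fun_eq_iff const_cochain_def rep1.twist_simps rep1.act_simps rep2.act_simps)
      fix F c assume "F \<in> ccochains 0"
      then obtain v where v: "be v = v" "\<And>x. act1 x v = act2 x v" "F = (\<lambda>i. if i = 0 then const_cochain v else 0)"
        unfolding ccochains_zero by blast
      show "fun_scale (fun_scale sv) c F \<in> ccochains 0"
        unfolding ccochains_zero
        by (rule exI[of _ "sv c v"])
          (auto simp: fun_eq_iff fun_scale_def const_cochain_def v rep1.twist_simps rep1.act_simps rep2.act_simps)
      fix G assume "G \<in> ccochains 0"
      then obtain w where w: "be w = w" "\<And>x. act1 x w = act2 x w" "G = (\<lambda>i. if i = 0 then const_cochain w else 0)"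
        unfolding ccochains_zero by blast
      show "F + G \<in> ccochains 0"
        unfolding ccochains_zero
        by (rule exI[of _ "v + w"])
          (auto simp: fun_eq_iff const_cochain_def v w rep1.twist_simps rep1.act_simps rep2.act_simps)
    qed
  next
    case False
    then show ?thesis
      unfolding cochain.subspace_def
      by (auto simp: ccochains_pos rep1.cochains_0 rep1.cochains_add fun_scale_def[of "fun_scale sv"] rep1.cochains_scale)
        (auto simp: fun_scale_def fun_eq_iff)
  qed
qed

lemma ccoboundary_add: "ccoboundary n (F + G) = ccoboundary n F + ccoboundary n G"
  by (auto simp: fun_eq_iff chom_coboundary_def rep1.coboundary_add rep2.coboundary_add)

lemma ccoboundary_scale:
  "ccoboundary n (fun_scale (fun_scale sv) c F) = fun_scale (fun_scale sv) c (ccoboundary n F)"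
  by (rule ext) (auto simp: chom_coboundary_def fun_scale_def[of "fun_scale sv"]
      rep1.coboundary_scale rep2.coboundary_scale,
      auto simp: fun_scale_def fun_eq_iff rep1.rep.scale_right_distrib)

lemma ccoboundary_cochain:
  assumes "F \<in> ccochains n"
  shows "ccoboundary n F \<in> ccochains (Suc n)"
proof (cases "n = 0")
  case True
  then have "F 0 \<in> rep1.cochains 0"
    using assms by (auto simp: ccochains_zero hom_cochains_def)
  then show ?thesis
    using True rep1.coboundary_cochain[of "F 0" 0]
    by (auto simp: ccochains_pos chom_coboundary_def rep1.cochains_0)
next
  case False
  then have F: "F i \<in> rep1.cochains n" "n < i \<Longrightarrow> F i = 0" "F 0 = 0" for i
    using assms by (auto simp: ccochains_pos)
  show ?thesis
    using False
    by (auto simp: ccochains_pos ccoboundary_pos[OF _ assms] F rep1.coboundary_0 rep2.coboundary_0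
        intro!: rep1.cochains_add rep1.coboundary_cochain rep2.coboundary_cochain rep1.cochains_0)
qed

text \<open>
  Entry \<open>i\<close> of the square is
  \<open>\<delta>\<^sub>1\<^sup>2 F\<^sub>i + (\<delta>\<^sub>1 \<delta>\<^sub>2 + \<delta>\<^sub>2 \<delta>\<^sub>1) F\<^sub>i\<^sub>-\<^sub>1 + \<delta>\<^sub>2\<^sup>2 F\<^sub>i\<^sub>-\<^sub>2\<close>.
\<close>

lemma ccoboundary_squared:
  assumes "F \<in> ccochains n" "0 < n"
  shows "ccoboundary (Suc n) (ccoboundary n F) = 0"
proof
  fix i
  have F: "F j \<in> rep1.cochains n" for j
    using assms by (simp add: ccochains_pos)
  note expand = ccoboundary_pos[OF zero_less_Suc ccoboundary_cochain[OF assms(1)]]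
    ccoboundary_pos[OF assms(2,1)]
  show "ccoboundary (Suc n) (ccoboundary n F) i = 0 i"
  proof (cases i)
    case 0
    then show ?thesis
      unfolding expand(1) unfolding expand(2)
      by (simp add: rep1.coboundary_0 rep2.coboundary_0 rep1.coboundary_squared F assms)
  next
    case (Suc j)
    then show ?thesis
      using coboundaries_anticommute[OF F assms(2), of j]
      unfolding expand(1) unfolding expand(2)
      by (cases j) (simp_all add: rep1.coboundary_add rep2.coboundary_add
          rep1.coboundary_squared rep2.coboundary_squared rep2.coboundary_0 F assms)
  qed
qed

lemma cochain_complex_chom: "cochain_complex (fun_scale (fun_scale sv)) ccochains ccoboundary"
  using vector_space_fun_scale[OF vector_space_fun_scale[OF rep1.rep.vector_space_axioms]]
  by (auto simp: cochain_complex_def cochain_complex_axioms_def linear_between_def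
      subspace_ccochains ccoboundary_cochain ccoboundary_add ccoboundary_scale ccoboundary_squared)

lemma triangle_commutes:
  assumes "F \<in> ccochains n"
  shows "triangle sv (Suc n) (ccoboundary n F) = sum.coboundary n (triangle sv n F)"
proof (cases "n = 0")
  case True
  then obtain v where v: "\<And>x. act1 x v = act2 x v" "F = (\<lambda>i. if i = 0 then const_cochain v else 0)"
    using assms by (auto simp: ccochains_zero)
  have half: "sv (1/2) w + sv (1/2) w = w" for w
    using rep1.rep.scale_left_distrib[of "1/2" "1/2" w] by simp
  show ?thesis
    by (auto simp: True triangle_def chom_coboundary_def hom_coboundary_def v(2) const_cochain_def
        fun_scale_def fun_eq_iff rep1.act_simps rep2.act_simps v(1)[symmetric] half)
next
  case False
  then have n: "0 < n" by simp
  have F: "F j \<in> rep1.cochains n" "F 0 = 0" "F (Suc n) = 0" for j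
    using assms n by (simp_all add: ccochains_pos)
  have "triangle sv (Suc n) (ccoboundary n F) = (\<Sum>i=1..Suc n. rep1.coboundary n (F i))
      + (\<Sum>i=1..Suc n. rep2.coboundary n (F (i - 1)))"
    unfolding triangle_def ccoboundary_pos[OF n assms] by (simp add: sum.distrib)
  also have "(\<Sum>i=1..Suc n. rep1.coboundary n (F i)) = (\<Sum>i=1..n. rep1.coboundary n (F i))"
    by (simp add: F rep1.coboundary_0)
  also have "(\<Sum>i=1..Suc n. rep2.coboundary n (F (i - 1))) = (\<Sum>i=0..n. rep2.coboundary n (F i))"
    by (rule sum.reindex_bij_witness[of _ Suc "\<lambda>i. i - 1"]) auto
  also have "\<dots> = (\<Sum>i=1..n. rep2.coboundary n (F i))"
    by (simp add: sum.atLeast_Suc_atMost F rep2.coboundary_0)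
  also have "(\<Sum>i=1..n. rep1.coboundary n (F i)) + (\<Sum>i=1..n. rep2.coboundary n (F i))
      = sum.coboundary n (\<Sum>i=1..n. F i)"
    by (simp add: sum.coboundary_sum coboundary_sum_eq[OF F(1) n] sum.distrib)
  also have "(\<Sum>i=1..n. F i) = triangle sv n F"
    using n by (simp add: triangle_def)
  finally show ?thesis .
qed

lemma triangle_linear:
  "linear_between (fun_scale (fun_scale sv)) (fun_scale sv) (ccochains n) (rep1.cochains n) (triangle sv n)"
proof -
  interpret cochain: vector_space "fun_scale sv :: 'k \<Rightarrow> ('g list \<Rightarrow> 'v) \<Rightarrow> _"
    by (rule vector_space_fun_scale) (rule rep1.rep.vector_space_axioms)
  have "triangle sv n F \<in> rep1.cochains n" if "F \<in> ccochains n" for F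
  proof (cases "n = 0")
    case True
    then have "F 0 \<in> rep1.cochains 0"
      using that by (auto simp: ccochains_zero hom_cochains_def)
    then show ?thesis by (simp add: True triangle_def rep1.cochains_scale)
  next
    case False
    then show ?thesis using that by (auto simp: triangle_def ccochains_pos intro: rep1.cochains_sum)
  qed
  moreover have "triangle sv n (F + G) = triangle sv n F + triangle sv n G"
    for F G :: "nat \<Rightarrow> 'g list \<Rightarrow> 'v"
    by (simp add: triangle_def sum.distrib cochain.scale_right_distrib)
  moreover have "triangle sv n (fun_scale (fun_scale sv) c F) = fun_scale sv c (triangle sv n F)"
    for c and F :: "nat \<Rightarrow> 'g list \<Rightarrow> 'v"
    by (simp add: triangle_def fun_scale_def[of "fun_scale sv"] cochain.scale_sum_right mult.commute)
  ultimately show ?thesis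
    unfolding linear_between_def by blast
qed

lemma cochain_morphism_triangle:
  "cochain_morphism (fun_scale (fun_scale sv)) ccochains ccoboundary
    (fun_scale sv) rep1.cochains sum.coboundary (triangle sv)"
  unfolding cochain_morphism_def cochain_morphism_axioms_def
  using cochain_complex_chom sum.cochain_complex_hom triangle_linear triangle_commutes by blast

end

section \<open>The induced map on cohomology\<close>

lemma (in vector_space) plus_subspace_absorb:
  assumes "subspace B" "A \<subseteq> B" "0 \<in> A"
  shows "A + B = B"
proof
  show "A + B \<subseteq> B"
    using assms by (auto elim!: set_plus_elim intro: subspace_add)
  show "B \<subseteq> A + B"
    using set_plus_intro[OF assms(3)] by fastforce
qed

context cochain_complex
begin

lemma subspace_coboundaries: "subspace (coboundaries C d n)"
proof (cases n)
  case 0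
  then show ?thesis by (simp add: coboundaries_def)
next
  case (Suc m)
  have "d m 0 = d m (s 0 0)" by simp
  also have "\<dots> = 0" 
    using differential[of m] subspace_0[OF subspace_cochains] unfolding linear_between_def by (metis scale_zero_left)
  finally show ?thesis
    using differential[of m] subspace_cochains[of m] unfolding linear_between_def Suc coboundaries_def
    unfolding subspace_def by (auto simp: image_iff) metis+
qed

lemma coboundaries_subset: "coboundaries C d n \<subseteq> C n"
  using differential[of "n - 1"] subspace_0[OF subspace_cochains]
  unfolding coboundaries_def linear_between_def by (cases n) auto

lemma cohomology_class_add:
  "cohomology_class C d n z + cohomology_class C d n w = cohomology_class C d n (z + w)"
  unfolding cohomology_class_def set_plus_rearrange
  by (simp add: plus_subspace_absorb subspace_coboundaries subspace_0)

lemma cohomology_class_scale: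
  "coset_scale s (coboundaries C d n) c (cohomology_class C d n z) = cohomology_class C d n (s c z)"
proof -
  have "s c ` cohomology_class C d n z = s c z +o (s c ` coboundaries C d n)"
    by (force simp: cohomology_class_def elt_set_plus_def scale_right_distrib)
  moreover have "s c ` coboundaries C d n + coboundaries C d n = coboundaries C d n"
    using subspace_coboundaries[of n]
    by (intro plus_subspace_absorb) (auto intro: subspace_scale simp: image_iff subspace_0 intro!: bexI[of _ 0])
  ultimately show ?thesis
    by (simp add: coset_scale_def cohomology_class_def set_plus_rearrange3)
qed

lemma cocycles_add_scale:
  "z \<in> cocycles C d n \<Longrightarrow> w \<in> cocycles C d n \<Longrightarrow> z + w \<in> cocycles C d n"
  "z \<in> cocycles C d n \<Longrightarrow> s c z \<in> cocycles C d n"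
  using differential[of n] subspace_cochains[of n]
  by (auto simp: cocycles_def linear_between_def subspace_add subspace_scale)

end

context cochain_morphism
begin

text \<open>
  The image of a coset is in general only part of a coset; adding the coboundaries of the target
  completes it.
\<close>

definition "class_map n A = \<phi> n ` A + coboundaries C' d' n"

lemma component_simps:
  "c \<in> C n \<Longrightarrow> \<phi> n c \<in> C' n"
  "c \<in> C n \<Longrightarrow> c' \<in> C n \<Longrightarrow> \<phi> n (c + c') = \<phi> n c + \<phi> n c'"
  "c \<in> C n \<Longrightarrow> \<phi> n (s k c) = s' k (\<phi> n c)"
  using component[of n] by (simp_all add: linear_between_def)

lemma component_0: "\<phi> n 0 = 0"
  using component_simps(3)[of 0 n 0] src.subspace_0[OF src.subspace_cochains] by simp

lemma component_coboundary: "b \<in> coboundaries C d n \<Longrightarrow> \<phi> n b \<in> coboundaries C' d' n"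
  by (cases n) (auto simp: coboundaries_def component_0 commutes component_simps)

lemma component_cocycle: "z \<in> cocycles C d n \<Longrightarrow> \<phi> n z \<in> cocycles C' d' n"
  by (auto simp: cocycles_def component_simps component_0 simp flip: commutes)

lemma class_map_class:
  assumes "z \<in> C n"
  shows "class_map n (cohomology_class C d n z) = cohomology_class C' d' n (\<phi> n z)"
proof -
  have "\<phi> n ` cohomology_class C d n z = \<phi> n z +o (\<phi> n ` coboundaries C d n)"
    using assms src.coboundaries_subset[of n]
    by (force simp: cohomology_class_def elt_set_plus_def component_simps)
  moreover have "\<phi> n ` coboundaries C d n + coboundaries C' d' n = coboundaries C' d' n"
    using src.subspace_0[OF src.subspace_coboundaries, of n] component_0[of n]
    by (intro tgt.plus_subspace_absorb tgt.subspace_coboundaries)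
      (auto simp: component_coboundary image_iff intro!: bexI[of _ 0])
  ultimately show ?thesis
    by (simp add: class_map_def cohomology_class_def set_plus_rearrange3)
qed

lemma class_map_linear:
  "linear_between (coset_scale s (coboundaries C d n)) (coset_scale s' (coboundaries C' d' n))
    (cohomology C d n) (cohomology C' d' n) (class_map n)"
proof -
  have C: "z \<in> C n" if "z \<in> cocycles C d n" for z
    using that by (simp add: cocycles_def)
  show ?thesis
    unfolding linear_between_def cohomology_def
    by (auto simp: class_map_class C component_cocycle src.cohomology_class_add tgt.cohomology_class_add
        src.cohomology_class_scale tgt.cohomology_class_scale src.cocycles_add_scale component_simps)
qed

end

theorem theorem4p3:
  fixes s :: "'k::field_char_0 \<Rightarrow> 'g::ab_group_add \<Rightarrow> 'g"
    and sv :: "'k \<Rightarrow> 'v::ab_group_add \<Rightarrow> 'v"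
    and br1 br2 :: "'g \<Rightarrow> 'g \<Rightarrow> 'g" and al :: "'g \<Rightarrow> 'g"
    and act1 act2 :: "'g \<Rightarrow> 'v \<Rightarrow> 'v" and be :: "'v \<Rightarrow> 'v"
    and C :: "nat \<Rightarrow> (nat \<Rightarrow> 'g list \<Rightarrow> 'v) set"
    and d :: "nat \<Rightarrow> (nat \<Rightarrow> 'g list \<Rightarrow> 'v) \<Rightarrow> nat \<Rightarrow> 'g list \<Rightarrow> 'v"
    and Cp :: "nat \<Rightarrow> ('g list \<Rightarrow> 'v) set"
    and dp :: "nat \<Rightarrow> ('g list \<Rightarrow> 'v) \<Rightarrow> 'g list \<Rightarrow> 'v"
  defines "C \<equiv> chom_cochains s al sv act1 act2 be"
    and "d \<equiv> chom_coboundary br1 br2 al sv act1 act2"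
    and "Cp \<equiv> hom_cochains s al sv be"
    and "dp \<equiv> hom_coboundary (br1 + br2) al sv (act1 + act2)"
  assumes "compatible_hom_lie_algebra s br1 br2 al"
    and "compatible_hom_lie_representation s br1 br2 al sv act1 act2 be"
  shows "hom_lie_algebra s (br1 + br2) al \<and>
    hom_lie_representation s (br1 + br2) al sv (act1 + act2) be \<and>
    cochain_morphism (fun_scale (fun_scale sv)) C d (fun_scale sv) Cp dp (triangle sv) \<and>
    (\<exists>\<Phi>. \<forall>n.
      linear_between
        (coset_scale (fun_scale (fun_scale sv)) (coboundaries C d n))
        (coset_scale (fun_scale sv) (coboundaries Cp dp n))
        (cohomology C d n) (cohomology Cp dp n) (\<Phi> n) \<and>
      (\<forall>z\<in>cocycles C d n.
        \<Phi> n (cohomology_class C d n z) = cohomology_class Cp dp n (triangle sv n z)))"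
proof -
  interpret compatible_representation s br1 br2 al sv act1 act2 be
    by (rule compatible_representation.intro) fact+
  interpret triangle: cochain_morphism "fun_scale (fun_scale sv)" C d "fun_scale sv" Cp dp "triangle sv"
    unfolding C_def d_def Cp_def dp_def by (rule cochain_morphism_triangle)
  have "triangle.class_map n (cohomology_class C d n z) = cohomology_class Cp dp n (triangle sv n z)"
    if "z \<in> cocycles C d n" for n z
    using that by (simp add: triangle.class_map_class cocycles_def)
  then show ?thesis
    using hom_lie_sum representation_sum triangle.cochain_morphism_axioms triangle.class_map_linear
    by blast
qed

end
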